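(* Let $K:\mathbb R^d\to\mathbb R$ be continuous and symmetric such that $K(x-y)$ is a (strictly) positive definite kernel with strictly positive Fourier transform $\hat K\in L_1(\mathbb R^d)\cap L_\infty(\mathbb R^d)$, and let $\Omega\subset\mathbb R^d$ be a bounded domain. Let $\varphi_n$ ($n\ge 0$) be the Mercer eigenfunctions of $K$ on $\Omega$ and $\varphi_n^E$ their eigensystem extensions to $\mathbb R^d$. Then $\mathcal H_K(\Omega)$ is the closure in $\mathcal H_K$ of the linear span of $\{\varphi_n^E: n\ge 0\}$.
   Context: $\mathcal H_K$ is the reproducing kernel Hilbert space on $\mathbb R^d$ with kernel $K(x-y)$, with inner product $(\cdot,\cdot)_K$. $\mathcal H_K(\Omega)$ is the $(\cdot,\cdot)_K$-orthogonal complement of $\{f\in\mathcal H_K: f=0\text{ on }\Omega\}$; equivalently, it is the $\mathcal H_K$-closure of the span of all translates $K(\cdot-x)$, $x\in\Omega$. The Mercer eigenfunctions $\varphi_n$ and eigenvalues $\kappa_n>0$, $n\ge 0$, form a complete $L_2(\Omega)$-orthonormal system of continuous eigenfunctions of the integral operator with kernel $K(x-y)$ on $L_2(\Omega)$: $$\kappa_n\varphi_n(x)=\int_\Omega K(x-y)\varphi_n(y)\,dy,\quad x\in\Omega,$$ and $K(x-y)=\sum_{n=0}^\infty\kappa_n\varphi_n(x)\varphi_n(y)$ for $x,y\in\Omega$. The eigensystem extension is defined by $$\kappa_n\varphi_n^E(x):=\int_\Omega K(x-y)\varphi_n(y)\,dy,\quad x\in\mathbb R^d .$$ *)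

theory Defs
  imports "HOL-Analysis.Analysis"
begin

text \<open>
  A reproducing kernel Hilbert space of real functions on \<^typ>\<open>'a\<close> is a Hilbert space
  \<^typ>\<open>'h\<close> together with an injective linear map \<open>ev\<close> into the real functions
  on \<^typ>\<open>'a\<close>: the abstract vector \<open>f\<close> stands for the function \<open>ev f\<close>.
  By the reproducing property, the kernel determines \<^typ>\<open>'h\<close> and \<open>ev\<close> up to an
  isometric isomorphism respecting \<open>ev\<close>.
\<close>

definition is_rkhs ::
    "('h::{real_inner, complete_space} \<Rightarrow> 'a \<Rightarrow> real) \<Rightarrow> ('a \<Rightarrow> 'a \<Rightarrow> real) \<Rightarrow> bool" where
  "is_rkhs ev k \<longleftrightarrow>
     inj ev \<and> (\<forall>x. linear (\<lambda>f. ev f x)) \<and>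
     (\<forall>x. \<exists>g. ev g = (\<lambda>y. k y x) \<and> (\<forall>f. ev f x = f \<bullet> g))"

definition rkhs_local ::
    "('h::{real_inner, complete_space} \<Rightarrow> 'a \<Rightarrow> real) \<Rightarrow> 'a set \<Rightarrow> 'h set" where
  "rkhs_local ev \<Omega> = orthogonal_comp {f. \<forall>x\<in>\<Omega>. ev f x = 0}"

definition strictly_pos_def_kernel :: "('a \<Rightarrow> 'a \<Rightarrow> real) \<Rightarrow> bool" where
  "strictly_pos_def_kernel k \<longleftrightarrow>
     (\<forall>X c. finite X \<and> (\<exists>x\<in>X. c x \<noteq> 0) \<longrightarrow> (\<Sum>x\<in>X. \<Sum>y\<in>X. c x * c y * k x y) > 0)"

fun iterated_partial :: "'a::euclidean_space list \<Rightarrow> ('a \<Rightarrow> complex) \<Rightarrow> 'a \<Rightarrow> complex" where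
  "iterated_partial [] f = f"
| "iterated_partial (b # bs) f = iterated_partial bs (\<lambda>x. frechet_derivative f (at x) b)"

definition schwartz_function :: "('a::euclidean_space \<Rightarrow> complex) \<Rightarrow> bool" where
  "schwartz_function f \<longleftrightarrow>
     (\<forall>bs. set bs \<subseteq> Basis \<longrightarrow>
        (\<forall>x. iterated_partial bs f differentiable (at x)) \<and>
        (\<forall>k::nat. bounded (range (\<lambda>x. norm x ^ k *\<^sub>R iterated_partial bs f x))))"

definition fourier :: "('a::euclidean_space \<Rightarrow> complex) \<Rightarrow> 'a \<Rightarrow> complex" where
  "fourier f \<xi> =
     ((2 * pi) powr (- real DIM('a) / 2)) *\<^sub>R (LINT x|lborel. f x * cis (- (x \<bullet> \<xi>)))"

text \<open>
  A continuous positive definite \<open>K\<close> is bounded but need not be integrable, so its Fourier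
  transform is the one of tempered distributions, here represented by a function. For integrable
  \<open>K\<close> this is the classical transform (up to null sets). The Bochner integrals below exist
  for bounded measurable \<open>K\<close> and integrable \<open>Khat\<close>.
\<close>

definition has_fourier_transform ::
    "('a::euclidean_space \<Rightarrow> real) \<Rightarrow> ('a \<Rightarrow> real) \<Rightarrow> bool" where
  "has_fourier_transform K Khat \<longleftrightarrow>
     (\<forall>f. schwartz_function f \<longrightarrow>
        (LINT x|lborel. of_real (K x) * fourier f x) = (LINT \<xi>|lborel. of_real (Khat \<xi>) * f \<xi>))"

definition L2_fun :: "'a::euclidean_space set \<Rightarrow> ('a \<Rightarrow> real) \<Rightarrow> bool" where
  "L2_fun \<Omega> f \<longleftrightarrow>
     f \<in> borel_measurable (lebesgue_on \<Omega>) \<and> integrable (lebesgue_on \<Omega>) (\<lambda>x. (f x)\<^sup>2)"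

definition complete_orthonormal_L2 ::
    "'a::euclidean_space set \<Rightarrow> (nat \<Rightarrow> 'a \<Rightarrow> real) \<Rightarrow> bool" where
  "complete_orthonormal_L2 \<Omega> \<phi> \<longleftrightarrow>
     (\<forall>n. L2_fun \<Omega> (\<phi> n)) \<and>
     (\<forall>m n. (LINT x|lebesgue_on \<Omega>. \<phi> m x * \<phi> n x) = (if m = n then 1 else 0)) \<and>
     (\<forall>f \<epsilon>. L2_fun \<Omega> f \<and> \<epsilon> > 0 \<longrightarrow>
        (\<exists>N c. (LINT x|lebesgue_on \<Omega>. (f x - (\<Sum>n<N. c n * \<phi> n x))\<^sup>2) < \<epsilon>))"

text \<open>Only the values of \<open>\<phi> n\<close> on \<open>\<Omega>\<close> are relevant.\<close>

definition mercer_system ::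
    "('a::euclidean_space \<Rightarrow> real) \<Rightarrow> 'a set \<Rightarrow> (nat \<Rightarrow> real) \<Rightarrow> (nat \<Rightarrow> 'a \<Rightarrow> real) \<Rightarrow> bool" where
  "mercer_system K \<Omega> \<kappa> \<phi> \<longleftrightarrow>
     complete_orthonormal_L2 \<Omega> \<phi> \<and>
     (\<forall>n. \<kappa> n > 0 \<and> continuous_on \<Omega> (\<phi> n)) \<and>
     (\<forall>n. \<forall>x\<in>\<Omega>. \<kappa> n * \<phi> n x = (LINT y|lebesgue_on \<Omega>. K (x - y) * \<phi> n y)) \<and>
     (\<forall>x\<in>\<Omega>. \<forall>y\<in>\<Omega>. (\<lambda>n. \<kappa> n * \<phi> n x * \<phi> n y) sums K (x - y))"

definition mercer_extension ::
    "('a::euclidean_space \<Rightarrow> real) \<Rightarrow> 'a set \<Rightarrow> (nat \<Rightarrow> real) \<Rightarrow> (nat \<Rightarrow> 'a \<Rightarrow> real) \<Rightarrow> nat \<Rightarrow> 'a \<Rightarrow> real" where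
  "mercer_extension K \<Omega> \<kappa> \<phi> n x = (LINT y|lebesgue_on \<Omega>. K (x - y) * \<phi> n y) / \<kappa> n"

end

theory Submission
  imports Defs
begin

text \<open>
  Integration against \<open>\<phi> n\<close> over \<open>\<Omega>\<close> is a bounded functional on the Hilbert
  space, and feeding kernel translates into it shows that its Riesz representer, divided by
  \<open>\<kappa> n\<close>, is a vector \<open>h n\<close> whose function is the extension of \<open>\<phi> n\<close>
  (\<open>rkhs_integral_representer\<close>). So \<open>f\<close> is orthogonal to every \<open>h n\<close> exactly when
  its function has all Fourier coefficients zero with respect to the complete system
  \<open>\<phi>\<close>, that is, when it vanishes almost everywhere on \<open>\<Omega>\<close>
  (\<open>complete_orthonormal_L2_coeffs_0\<close>). Functions in the space are continuous because
  \<open>K\<close> is, and \<open>\<Omega>\<close> is open, so this means that the function vanishes at every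
  point of \<open>\<Omega>\<close>. Hence the orthogonal complement of \<open>range h\<close> is the space whose
  complement defines the local space, and the claim is the bipolar identity
  \<open>orthogonal_comp_comp_eq_closure_span\<close> in a Hilbert space.

  Both Hilbert space facts, Riesz representation and the bipolar identity, come from the
  existence of a point of least norm in a closed convex set.
\<close>

section \<open>Least norm, Riesz representation and double orthogonal complements\<close>

text \<open>
  A minimising sequence is Cauchy: the midpoint of two of its members lies in the set, hence is
  not shorter than the infimum, and the parallelogram law then bounds their distance.
\<close>

lemma closed_convex_least_norm:
  fixes C :: "'h::{real_inner, complete_space} set"
  assumes "closed C" "convex C" "C \<noteq> {}"
  obtains z where "z \<in> C" "\<And>w. w \<in> C \<Longrightarrow> norm z \<le> norm w"
proof -
  define D where "D = (INF w\<in>C. (norm w)\<^sup>2)"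
  have bdd: "bdd_below ((\<lambda>w. (norm w)\<^sup>2) ` C)"
    by (rule bdd_belowI2[of _ 0]) simp
  have D_le: "D \<le> (norm w)\<^sup>2" if "w \<in> C" for w
    unfolding D_def by (rule cINF_lower[OF bdd that])
  have "\<exists>w\<in>C. (norm w)\<^sup>2 < D + inverse (real (Suc n))" for n
  proof -
    have "D < D + inverse (real (Suc n))"
      by simp
    then show ?thesis
      unfolding D_def using cINF_less_iff[OF assms(3) bdd] by blast
  qed
  then obtain w where wC: "\<And>n. w n \<in> C"
    and w_less: "\<And>n. (norm (w n))\<^sup>2 < D + inverse (real (Suc n))"
    by metis
  have gap: "(dist (w m) (w n))\<^sup>2 < 2 * inverse (real (Suc m)) + 2 * inverse (real (Suc n))" for m n
  proof -
    have "(1/2) *\<^sub>R w m + (1/2) *\<^sub>R w n \<in> C"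
      using assms(2) wC by (intro convexD) auto
    then have "D \<le> (norm ((1/2) *\<^sub>R w m + (1/2) *\<^sub>R w n))\<^sup>2"
      by (rule D_le)
    moreover have "(dist (w m) (w n))\<^sup>2 =
        2 * (norm (w m))\<^sup>2 + 2 * (norm (w n))\<^sup>2 - 4 * (norm ((1/2) *\<^sub>R w m + (1/2) *\<^sub>R w n))\<^sup>2"
      unfolding dist_norm power2_norm_eq_inner
      by (simp add: inner_simps inner_commute algebra_simps)
    ultimately show ?thesis
      using w_less[of m] w_less[of n] by linarith
  qed
  have "Cauchy w"
  proof (rule metric_CauchyI)
    fix e :: real assume "e > 0"
    then obtain N where N: "inverse (real (Suc N)) < e\<^sup>2 / 4"
      using reals_Archimedean[of "e\<^sup>2 / 4"] by auto
    have "dist (w m) (w n) < e" if "m \<ge> N" "n \<ge> N" for m n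
    proof -
      have "inverse (real (Suc k)) \<le> inverse (real (Suc N))" if "k \<ge> N" for k
        using that by (simp add: field_simps)
      from this[OF that(1)] this[OF that(2)] have "(dist (w m) (w n))\<^sup>2 < e\<^sup>2"
        using gap[of m n] N by linarith
      then show ?thesis
        using \<open>e > 0\<close> by (simp add: power_less_imp_less_base)
    qed
    then show "\<exists>N. \<forall>m\<ge>N. \<forall>n\<ge>N. dist (w m) (w n) < e"
      by blast
  qed
  then obtain z where z: "w \<longlonglongrightarrow> z"
    using Cauchy_convergent_iff convergent_def by blast
  have zC: "z \<in> C"
    using closed_sequentially[OF assms(1)] wC z by blast
  have lim_upper: "(\<lambda>n. D + inverse (real (Suc n))) \<longlonglongrightarrow> D + 0"
    by (intro tendsto_add tendsto_const LIMSEQ_inverse_real_of_nat)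
  have lim_norm: "(\<lambda>n. (norm (w n))\<^sup>2) \<longlonglongrightarrow> (norm z)\<^sup>2"
    by (intro tendsto_intros z)
  have "(norm z)\<^sup>2 \<le> D + 0"
    by (rule LIMSEQ_le[OF lim_norm lim_upper]) (use w_less less_imp_le in blast)
  then have "(norm z)\<^sup>2 \<le> (norm v)\<^sup>2" if "v \<in> C" for v
    using D_le[OF that] by linarith
  then have "norm z \<le> norm v" if "v \<in> C" for v
    using that power2_le_imp_le norm_ge_zero by blast
  with zC show ?thesis
    by (rule that)
qed

lemma least_norm_on_line_orthogonal:
  fixes z v :: "'h::real_inner"
  assumes least: "\<And>t. norm z \<le> norm (z + t *\<^sub>R v)"
  shows "z \<bullet> v = 0"
proof (cases "v = 0")
  case False
  then have pos: "v \<bullet> v > 0"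
    by simp
  \<comment> \<open>the step \<open>t\<close> minimises the quadratic \<open>norm (z + t *\<^sub>R v) ^ 2\<close>\<close>
  define t where "t = - (z \<bullet> v) / (v \<bullet> v)"
  have "(norm z)\<^sup>2 \<le> (norm (z + t *\<^sub>R v))\<^sup>2"
    using least by (intro power_mono) auto
  then have "0 \<le> 2 * t * (z \<bullet> v) + t * (t * (v \<bullet> v))"
    unfolding power2_norm_eq_inner by (simp add: inner_simps inner_commute algebra_simps)
  also have "t * (v \<bullet> v) = - (z \<bullet> v)"
    using pos by (simp add: t_def)
  finally have "(z \<bullet> v)\<^sup>2 \<le> 0"
    using pos by (simp add: t_def power2_eq_square field_simps)
  then show ?thesis
    by simp
qed simp

text \<open>
  The point \<open>z\<close> of least norm on the hyperplane where the functional is 1 is orthogonal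
  to the kernel, so the functional is inner multiplication with \<open>z\<close>, suitably scaled.
\<close>

lemma riesz_representation:
  fixes L :: "'h::{real_inner, complete_space} \<Rightarrow> real"
  assumes L: "bounded_linear L"
  obtains h where "\<And>f. L f = f \<bullet> h"
proof (cases "\<forall>f. L f = 0")
  case True
  then show ?thesis
    using that[of 0] by simp
next
  case False
  interpret L: bounded_linear L by (rule L)
  obtain u where "L u \<noteq> 0"
    using False by blast
  define C where "C = {f. L f = 1}"
  have "L (u /\<^sub>R L u) = 1"
    using \<open>L u \<noteq> 0\<close> by (simp add: L.scaleR)
  then have "C \<noteq> {}"
    by (auto simp: C_def)
  moreover have "closed C"
    unfolding C_def by (intro closed_Collect_eq continuous_on_const L.continuous_on continuous_on_id)
  moreover have "convex C"
    by (auto simp: convex_def C_def L.add L.scaleR)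
  ultimately obtain z where z: "z \<in> C" "\<And>w. w \<in> C \<Longrightarrow> norm z \<le> norm w"
    using closed_convex_least_norm by blast
  then have Lz: "L z = 1" and "z \<noteq> 0"
    using L.zero by (auto simp: C_def)
  have "L f = f \<bullet> (z /\<^sub>R (z \<bullet> z))" for f
  proof -
    have "z \<bullet> (f - L f *\<^sub>R z) = 0"
    proof (rule least_norm_on_line_orthogonal)
      show "norm z \<le> norm (z + t *\<^sub>R (f - L f *\<^sub>R z))" for t
        using Lz by (intro z(2)) (simp add: C_def L.add L.diff L.scaleR)
    qed
    then have "z \<bullet> f = L f * (z \<bullet> z)"
      by (simp add: inner_diff_right)
    then show ?thesis
      using \<open>z \<noteq> 0\<close> by (simp add: inner_commute)
  qed
  then show ?thesis
    by (rule that)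
qed

lemma subspace_closure:
  fixes S :: "'h::real_normed_vector set"
  assumes "subspace S"
  shows "subspace (closure S)"
proof (rule subspaceI)
  show "0 \<in> closure S"
    using subspace_0[OF assms] closure_subset by blast
  show "x + y \<in> closure S" if xy: "x \<in> closure S" "y \<in> closure S" for x y
  proof -
    obtain u v where "\<And>n. u n \<in> S" "u \<longlonglongrightarrow> x" "\<And>n. v n \<in> S" "v \<longlonglongrightarrow> y"
      using xy unfolding closure_sequential by blast
    then show ?thesis
      unfolding closure_sequential
      by (intro exI[of _ "\<lambda>n. u n + v n"]) (simp add: tendsto_add subspace_add[OF assms])
  qed
  show "c *\<^sub>R x \<in> closure S" if x: "x \<in> closure S" for c x
  proof -
    obtain u where "\<And>n. u n \<in> S" "u \<longlonglongrightarrow> x"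
      using x unfolding closure_sequential by blast
    then show ?thesis
      unfolding closure_sequential
      by (intro exI[of _ "\<lambda>n. c *\<^sub>R u n"]) (simp add: tendsto_scaleR subspace_scale[OF assms])
  qed
qed

text \<open>
  For the nontrivial inclusion, the shortest vector in \<open>x + closure (span S)\<close> is orthogonal to
  \<open>S\<close>, hence to \<open>x\<close> and to \<open>closure (span S)\<close>, hence to itself.
\<close>

lemma orthogonal_comp_comp_eq_closure_span:
  fixes S :: "'h::{real_inner, complete_space} set"
  shows "orthogonal_comp (orthogonal_comp S) = closure (span S)"
proof
  define M where "M = closure (span S)"
  have subspace_M: "subspace M"
    unfolding M_def by (simp add: subspace_closure)
  have M_sub: "M \<subseteq> orthogonal_comp (orthogonal_comp S)"
  proof -
    have "closed (orthogonal_comp (orthogonal_comp S))"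
      unfolding orthogonal_comp_def orthogonal_def
      by (simp only: Collect_ball_eq) (intro closed_INT ballI closed_Collect_eq continuous_intros)
    then show ?thesis
      unfolding M_def
      by (intro closure_minimal span_minimal orthogonal_comp_subset subspace_orthogonal_comp)
  qed
  then show "closure (span S) \<subseteq> orthogonal_comp (orthogonal_comp S)"
    by (simp add: M_def)
  have S_M: "S \<subseteq> M"
    unfolding M_def using closure_subset span_superset by blast
  show "orthogonal_comp (orthogonal_comp S) \<subseteq> closure (span S)"
  proof
    fix x assume x: "x \<in> orthogonal_comp (orthogonal_comp S)"
    have "closed ((+) x ` M)" "convex ((+) x ` M)" "(+) x ` M \<noteq> {}"
      using subspace_M subspace_0 by (auto simp: M_def closed_translation subspace_imp_convex)
    then obtain z where z: "z \<in> (+) x ` M" "\<And>w. w \<in> (+) x ` M \<Longrightarrow> norm z \<le> norm w"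
      using closed_convex_least_norm by blast
    then obtain p where p: "p \<in> M" "z = x + p"
      by blast
    have z_M: "z \<bullet> v = 0" if "v \<in> M" for v
    proof (rule least_norm_on_line_orthogonal)
      fix t
      have "p + t *\<^sub>R v \<in> M"
        using subspace_M p that by (simp add: subspace_add subspace_scale)
      then show "norm z \<le> norm (z + t *\<^sub>R v)"
        using p(2) by (intro z(2)) (auto simp: add.assoc)
    qed
    then have "z \<in> orthogonal_comp S"
      using S_M by (auto simp: orthogonal_comp_def orthogonal_def inner_commute)
    then have "z \<bullet> x = 0"
      using x by (auto simp: orthogonal_comp_def orthogonal_def)
    then have "z \<bullet> z = 0"
      using z_M[OF p(1)] by (simp add: p(2) inner_add_right)
    then have "x = - p"
      using p(2) by (simp add: eq_neg_iff_add_eq_0)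
    then show "x \<in> closure (span S)"
      using subspace_neg[OF subspace_M p(1)] by (simp add: M_def)
  qed
qed

section \<open>Reproducing kernel Hilbert spaces\<close>

lemma is_rkhs_representers:
  assumes "is_rkhs ev k"
  obtains g where "\<And>x. ev (g x) = (\<lambda>y. k y x)" "\<And>f x. ev f x = f \<bullet> g x"
  using assms unfolding is_rkhs_def by metis

lemma is_rkhs_bound:
  assumes "is_rkhs ev k"
  shows "\<bar>ev f x\<bar> \<le> norm f * sqrt (k x x)"
proof -
  obtain g where g: "\<And>x. ev (g x) = (\<lambda>y. k y x)" "\<And>f x. ev f x = f \<bullet> g x"
    using is_rkhs_representers[OF assms] by blast
  have "norm (g x) = sqrt (k x x)"
    using g(2)[of "g x" x] by (simp add: g(1) norm_eq_sqrt_inner)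
  then show ?thesis
    using Cauchy_Schwarz_ineq2[of f "g x"] by (simp add: g(2))
qed

text \<open>
  The representer of evaluation at \<open>y\<close> depends continuously on \<open>y\<close>: by the
  reproducing property, the squared distance between two of them is
  \<open>2 * K 0 - 2 * K (y - x)\<close>.
\<close>

lemma is_rkhs_translation_kernel_continuous:
  fixes K :: "'a::real_normed_vector \<Rightarrow> real"
  assumes rkhs: "is_rkhs ev (\<lambda>x y. K (x - y))"
    and cont: "continuous_on UNIV K"
    and sym: "\<And>x. K (- x) = K x"
  shows "continuous_on UNIV (ev f)"
proof -
  obtain g where g: "\<And>x. ev (g x) = (\<lambda>y. K (y - x))" "\<And>f x. ev f x = f \<bullet> g x"
    using is_rkhs_representers[OF rkhs] by blast
  have inner_g: "g x \<bullet> g y = K (y - x)" for x y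
    using g(2)[of "g x" y] by (simp add: g(1))
  have norm_g: "norm (g y - g x) = sqrt (2 * K 0 - 2 * K (y - x))" for x y
    using sym[of "y - x"] by (simp add: norm_eq_sqrt_inner inner_diff inner_g)
  have K_lim: "((\<lambda>y. K (y - x)) \<longlongrightarrow> K 0) (at x)" for x
  proof -
    have "continuous_on UNIV (\<lambda>y. K (y - x))"
      by (intro continuous_on_compose2[OF cont] continuous_intros) auto
    then show ?thesis
      by (metis (no_types, lifting) UNIV_I continuous_on_def diff_self)
  qed
  have "(g \<longlongrightarrow> g x) (at x)" for x
  proof -
    have "((\<lambda>y. sqrt (2 * K 0 - 2 * K (y - x))) \<longlongrightarrow> sqrt (2 * K 0 - 2 * K 0)) (at x)"
      by (intro tendsto_intros K_lim)
    then have "((\<lambda>y. norm (g y - g x)) \<longlongrightarrow> 0) (at x)"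
      by (simp add: norm_g)
    then show ?thesis
      by (rule LIM_zero_cancel[OF tendsto_norm_zero_cancel])
  qed
  then have "continuous_on UNIV g"
    by (simp add: continuous_on_def)
  then have "continuous_on UNIV (\<lambda>x. f \<bullet> g x)"
    by (intro continuous_intros)
  then show ?thesis
    by (simp add: g(2) cong: continuous_on_cong)
qed

text \<open>
  The vector \<open>h\<close> is the weak integral of the kernel translates against the weight
  \<open>w\<close>. It represents the functional \<open>f \<mapsto> LINT y|M. ev f y * w y\<close>, which is
  bounded because point evaluations are bounded uniformly in the point; its values come from
  applying the functional to the kernel translates themselves.
\<close>

lemma rkhs_integral_representer:
  fixes ev :: "'h::{real_inner, complete_space} \<Rightarrow> 'a \<Rightarrow> real"
  assumes rkhs: "is_rkhs ev k"
    and meas: "\<And>f. ev f \<in> borel_measurable M"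
    and bound: "\<And>y. k y y \<le> B"
    and w: "integrable M w"
  obtains h where "\<And>f. f \<bullet> h = (LINT y|M. ev f y * w y)"
    and "\<And>x. ev h x = (LINT y|M. k y x * w y)"
proof -
  obtain g where g: "\<And>x. ev (g x) = (\<lambda>y. k y x)" "\<And>f x. ev f x = f \<bullet> g x"
    using is_rkhs_representers[OF rkhs] by blast
  have dom: "\<bar>ev f y * w y\<bar> \<le> (norm f * sqrt B) * \<bar>w y\<bar>" for f y
  proof -
    have "\<bar>ev f y\<bar> \<le> norm f * sqrt B"
      using is_rkhs_bound[OF rkhs, of f y] bound[of y]
      by (meson mult_left_mono norm_ge_zero order_trans real_sqrt_le_mono)
    then show ?thesis
      by (simp add: abs_mult mult_right_mono)
  qed
  have int: "integrable M (\<lambda>y. ev f y * w y)" for f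
  proof (rule Bochner_Integration.integrable_bound)
    show "integrable M (\<lambda>y. (norm f * sqrt B) * \<bar>w y\<bar>)"
      using w by simp
    show "(\<lambda>y. ev f y * w y) \<in> borel_measurable M"
      using meas w by auto
    show "AE y in M. norm (ev f y * w y) \<le> norm ((norm f * sqrt B) * \<bar>w y\<bar>)"
      using dom[of f] by (auto intro!: AE_I2 order_trans[OF _ abs_ge_self])
  qed
  have "bounded_linear (\<lambda>f. LINT y|M. ev f y * w y)"
  proof (rule bounded_linear_intro)
    show "(LINT y|M. ev (f1 + f2) y * w y) = (LINT y|M. ev f1 y * w y) + (LINT y|M. ev f2 y * w y)"
      for f1 f2
    proof -
      have "(LINT y|M. ev (f1 + f2) y * w y) = (LINT y|M. ev f1 y * w y + ev f2 y * w y)"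
        by (intro Bochner_Integration.integral_cong) (simp_all add: g(2) inner_simps algebra_simps)
      then show ?thesis
        by (simp add: int)
    qed
    show "(LINT y|M. ev (r *\<^sub>R f) y * w y) = r *\<^sub>R (LINT y|M. ev f y * w y)" for r f
      by (simp add: g(2) mult.assoc)
    show "norm (LINT y|M. ev f y * w y) \<le> norm f * (sqrt B * (LINT y|M. \<bar>w y\<bar>))" for f
    proof -
      have "norm (LINT y|M. ev f y * w y) \<le> (LINT y|M. (norm f * sqrt B) * \<bar>w y\<bar>)"
        using dom w int by (intro order_trans[OF integral_norm_bound integral_mono]) auto
      then show ?thesis
        by (simp add: mult.assoc)
    qed
  qed
  then obtain h where h: "\<And>f. (LINT y|M. ev f y * w y) = f \<bullet> h"
    using riesz_representation by blast
  moreover have "ev h x = (LINT y|M. k y x * w y)" for x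
    using h[of "g x"] by (simp add: g inner_commute)
  ultimately show ?thesis
    using that[of h] by simp
qed

section \<open>Square-integrable functions\<close>

lemma L2_fun_mult_integrable:
  assumes "L2_fun \<Omega> f" "L2_fun \<Omega> g"
  shows "integrable (lebesgue_on \<Omega>) (\<lambda>x. f x * g x)"
proof (rule Bochner_Integration.integrable_bound)
  show "integrable (lebesgue_on \<Omega>) (\<lambda>x. (f x)\<^sup>2 + (g x)\<^sup>2)"
    using assms by (simp add: L2_fun_def)
  show "(\<lambda>x. f x * g x) \<in> borel_measurable (lebesgue_on \<Omega>)"
    using assms by (auto simp: L2_fun_def intro!: borel_measurable_times)
  have "\<bar>a * b\<bar> \<le> a\<^sup>2 + b\<^sup>2" for a b :: real
  proof -
    have "0 \<le> (\<bar>a\<bar> - \<bar>b\<bar>)\<^sup>2 + a\<^sup>2 + b\<^sup>2"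
      by simp
    then show ?thesis
      by (simp add: power2_diff abs_mult)
  qed
  then show "AE x in lebesgue_on \<Omega>. norm (f x * g x) \<le> norm ((f x)\<^sup>2 + (g x)\<^sup>2)"
    by simp
qed

lemma L2_fun_diff:
  assumes "L2_fun \<Omega> f" "L2_fun \<Omega> g"
  shows "L2_fun \<Omega> (\<lambda>x. f x - g x)"
  using assms L2_fun_mult_integrable[OF assms]
  by (auto simp: L2_fun_def power2_diff mult.assoc intro!: borel_measurable_diff)

lemma L2_fun_add:
  assumes "L2_fun \<Omega> f" "L2_fun \<Omega> g"
  shows "L2_fun \<Omega> (\<lambda>x. f x + g x)"
  using assms L2_fun_mult_integrable[OF assms]
  by (auto simp: L2_fun_def power2_sum mult.assoc intro!: borel_measurable_add)

lemma L2_fun_linear_combination: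
  assumes "\<And>n. L2_fun \<Omega> (\<phi> n)"
  shows "L2_fun \<Omega> (\<lambda>x. \<Sum>n<(N::nat). c n * \<phi> n x)"
proof (induction N)
  case 0
  then show ?case
    by (simp add: L2_fun_def)
next
  case (Suc N)
  have "L2_fun \<Omega> (\<lambda>x. c N * \<phi> N x)"
    using assms[of N] by (auto simp: L2_fun_def power_mult_distrib intro!: borel_measurable_times)
  then show ?case
    using L2_fun_add[OF Suc] by simp
qed

lemma L2_fun_integrable:
  assumes "L2_fun \<Omega> f" "\<Omega> \<in> lmeasurable"
  shows "integrable (lebesgue_on \<Omega>) f"
proof -
  have "L2_fun \<Omega> (\<lambda>x. 1)"
    using assms(2) by (simp add: L2_fun_def finite_measure.integrable_const finite_measure_lebesgue_on)
  from L2_fun_mult_integrable[OF assms(1) this] show ?thesis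
    by simp
qed

text \<open>
  A function orthogonal to all \<open>\<phi> n\<close> is at least as far from any of their linear
  combinations as from 0, because the mixed term in the square of the difference integrates to 0.
\<close>

lemma complete_orthonormal_L2_coeffs_0:
  assumes compl: "complete_orthonormal_L2 \<Omega> \<phi>"
    and f: "L2_fun \<Omega> f"
    and coeffs: "\<And>n. (LINT x|lebesgue_on \<Omega>. f x * \<phi> n x) = 0"
  shows "(LINT x|lebesgue_on \<Omega>. (f x)\<^sup>2) = 0"
proof -
  have \<phi>: "L2_fun \<Omega> (\<phi> n)" for n
    using compl by (simp add: complete_orthonormal_L2_def)
  have "(LINT x|lebesgue_on \<Omega>. (f x)\<^sup>2) \<le> e" if "e > 0" for e
  proof -
    obtain N c where less: "(LINT x|lebesgue_on \<Omega>. (f x - (\<Sum>n<N. c n * \<phi> n x))\<^sup>2) < e"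
      using compl f \<open>e > 0\<close> unfolding complete_orthonormal_L2_def by blast
    define s where "s x = (\<Sum>n<N. c n * \<phi> n x)" for x
    have s: "L2_fun \<Omega> s"
      unfolding s_def by (rule L2_fun_linear_combination) (rule \<phi>)
    have "(LINT x|lebesgue_on \<Omega>. f x * s x) =
        (LINT x|lebesgue_on \<Omega>. (\<Sum>n<N. c n * (f x * \<phi> n x)))"
      by (simp add: s_def sum_distrib_left mult_ac)
    also have "\<dots> = 0"
      by (simp add: Bochner_Integration.integral_sum L2_fun_mult_integrable[OF f \<phi>] coeffs)
    finally have fs: "(LINT x|lebesgue_on \<Omega>. f x * s x) = 0" .
    have int_f: "integrable (lebesgue_on \<Omega>) (\<lambda>x. (f x)\<^sup>2)"
      using f by (simp add: L2_fun_def)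
    have int_fs: "integrable (lebesgue_on \<Omega>) (\<lambda>x. f x * s x)"
      by (rule L2_fun_mult_integrable[OF f s])
    have "(LINT x|lebesgue_on \<Omega>. (f x)\<^sup>2) = (LINT x|lebesgue_on \<Omega>. (f x)\<^sup>2 - 2 * (f x * s x))"
      using int_f int_fs fs by simp
    also have "\<dots> \<le> (LINT x|lebesgue_on \<Omega>. (f x - s x)\<^sup>2)"
      using int_f int_fs L2_fun_diff[OF f s]
      by (intro integral_mono) (auto simp: L2_fun_def power2_diff)
    finally show ?thesis
      using less by (simp add: s_def)
  qed
  then have "(LINT x|lebesgue_on \<Omega>. (f x)\<^sup>2) \<le> 0"
    by (rule field_le_epsilon) simp
  then show ?thesis
    by (simp add: order_antisym)
qed

text \<open>
  The set where \<open>f\<close> does not vanish is open and null, and nonempty open sets have positive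
  measure.
\<close>

lemma continuous_on_open_integral_square_0:
  fixes f :: "'a::euclidean_space \<Rightarrow> real"
  assumes "open \<Omega>" "continuous_on \<Omega> f" "L2_fun \<Omega> f"
    and zero: "(LINT x|lebesgue_on \<Omega>. (f x)\<^sup>2) = 0" and "x \<in> \<Omega>"
  shows "f x = 0"
proof -
  have \<Omega>: "\<Omega> \<in> sets lebesgue"
    using \<open>open \<Omega>\<close> by simp
  have "AE x in lebesgue_on \<Omega>. (f x)\<^sup>2 = 0"
    using zero assms(3) integral_nonneg_eq_0_iff_AE[of "lebesgue_on \<Omega>" "\<lambda>x. (f x)\<^sup>2"]
    by (simp add: L2_fun_def)
  then have "AE x in lebesgue. x \<in> \<Omega> \<longrightarrow> f x = 0"
    using \<Omega> by (simp add: AE_restrict_space_iff)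
  moreover define U where "U = {x \<in> \<Omega>. f x \<noteq> 0}"
  have "open U"
  proof -
    have "U = \<Omega> \<inter> f -` (- {0})"
      by (auto simp: U_def)
    then show ?thesis
      using continuous_open_preimage[OF assms(2,1), of "- {0}"] by (simp add: open_Compl)
  qed
  ultimately have "U \<in> null_sets lebesgue"
    by (subst AE_iff_null_sets) (auto simp: U_def elim: eventually_mono)
  then have "U = {}"
    using \<open>open U\<close> open_not_negligible negligible_iff_null_sets by blast
  then show ?thesis
    using \<open>x \<in> \<Omega>\<close> by (auto simp: U_def)
qed

section \<open>Density of the extended eigenfunctions\<close>

theorem lemma4:
  fixes K Khat :: "'a::euclidean_space \<Rightarrow> real"
    and \<Omega> :: "'a set"
    and ev :: "'h::{real_inner, complete_space} \<Rightarrow> 'a \<Rightarrow> real"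
    and \<kappa> :: "nat \<Rightarrow> real"
    and \<phi> :: "nat \<Rightarrow> 'a \<Rightarrow> real"
  assumes K_continuous: "continuous_on UNIV K"
    and K_symmetric: "\<And>x. K (- x) = K x"
    and K_pos_def: "strictly_pos_def_kernel (\<lambda>x y. K (x - y))"
    and K_fourier: "has_fourier_transform K Khat"
    and Khat_pos: "\<And>\<xi>. Khat \<xi> > 0"
    and Khat_L1: "integrable lborel Khat"
    and Khat_Linf: "\<exists>B. AE \<xi> in lborel. \<bar>Khat \<xi>\<bar> \<le> B"
    and \<Omega>_domain: "open \<Omega>" "connected \<Omega>" "\<Omega> \<noteq> {}"
    and \<Omega>_bounded: "bounded \<Omega>"
    and rkhs: "is_rkhs ev (\<lambda>x y. K (x - y))"
    and mercer: "mercer_system K \<Omega> \<kappa> \<phi>"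
  shows "range (mercer_extension K \<Omega> \<kappa> \<phi>) \<subseteq> range ev \<and>
         rkhs_local ev \<Omega> = closure (span (ev -` range (mercer_extension K \<Omega> \<kappa> \<phi>)))"
proof -
  let ?M = "lebesgue_on \<Omega>"
  have \<Omega>: "\<Omega> \<in> lmeasurable"
    by (simp add: \<Omega>_bounded \<Omega>_domain(1) lmeasurable_open)
  have compl: "complete_orthonormal_L2 \<Omega> \<phi>" and \<kappa>: "\<And>n. \<kappa> n > 0"
    using mercer by (auto simp: mercer_system_def)
  have \<phi>: "L2_fun \<Omega> (\<phi> n)" for n
    using compl by (simp add: complete_orthonormal_L2_def)
  have cont: "continuous_on \<Omega> (ev f)" for f
    using is_rkhs_translation_kernel_continuous[OF rkhs K_continuous K_symmetric]
    by (rule continuous_on_subset) simp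
  have meas: "ev f \<in> borel_measurable ?M" for f
    using continuous_imp_measurable_on_sets_lebesgue[OF cont] \<Omega> by (simp add: fmeasurableD)
  have L2: "L2_fun \<Omega> (ev f)" for f
  proof -
    have "\<bar>ev f x\<bar> \<le> norm f * sqrt (K 0)" for x
      using is_rkhs_bound[OF rkhs, of f x] by simp
    then have "(ev f x)\<^sup>2 \<le> (norm f * sqrt (K 0))\<^sup>2" for x
      by (metis abs_ge_zero power2_abs power_mono)
    then have "integrable ?M (\<lambda>x. (ev f x)\<^sup>2)"
      using meas[of f] finite_measure_lebesgue_on[OF \<Omega>]
      by (intro finite_measure.integrable_const_bound[where B = "(norm f * sqrt (K 0))\<^sup>2"]) auto
    then show ?thesis
      using meas by (simp add: L2_fun_def)
  qed

  have "\<exists>h. (\<forall>f. f \<bullet> h = (LINT y|?M. ev f y * \<phi> n y) / \<kappa> n) \<and>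
      ev h = mercer_extension K \<Omega> \<kappa> \<phi> n" for n
  proof -
    have "integrable ?M (\<lambda>y. \<phi> n y / \<kappa> n)"
      using L2_fun_integrable[OF \<phi> \<Omega>] by simp
    then obtain h where h: "\<And>f. f \<bullet> h = (LINT y|?M. ev f y * (\<phi> n y / \<kappa> n))"
      "\<And>x. ev h x = (LINT y|?M. K (y - x) * (\<phi> n y / \<kappa> n))"
      using rkhs_integral_representer[OF rkhs meas, of "K 0" "\<lambda>y. \<phi> n y / \<kappa> n"] by auto
    have "K (y - x) = K (x - y)" for x y
      using K_symmetric[of "x - y"] by simp
    then have "ev h = mercer_extension K \<Omega> \<kappa> \<phi> n"
      by (simp add: fun_eq_iff h(2) mercer_extension_def)
    with h(1) show ?thesis
      by auto
  qed
  then obtain h where h: "\<And>n f. f \<bullet> h n = (LINT y|?M. ev f y * \<phi> n y) / \<kappa> n"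
    and ev_h: "\<And>n. ev (h n) = mercer_extension K \<Omega> \<kappa> \<phi> n"
    by metis

  have range_ext: "range (mercer_extension K \<Omega> \<kappa> \<phi>) = ev ` range h"
    by (auto simp: ev_h[symmetric])
  have preimage: "ev -` range (mercer_extension K \<Omega> \<kappa> \<phi>) = range h"
    using rkhs unfolding range_ext is_rkhs_def by (simp add: inj_vimage_image_eq)
  have "orthogonal_comp (range h) = {f. \<forall>x\<in>\<Omega>. ev f x = 0}"
  proof (intro equalityI subsetI CollectI ballI)
    fix f x assume f: "f \<in> orthogonal_comp (range h)" and "x \<in> \<Omega>"
    have "f \<bullet> h n = 0" for n
      using f by (auto simp: orthogonal_comp_def orthogonal_def inner_commute)
    then have "(LINT y|?M. ev f y * \<phi> n y) = 0" for n
      using h[of f n] \<kappa>[of n] by simp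
    then have "(LINT y|?M. (ev f y)\<^sup>2) = 0"
      by (rule complete_orthonormal_L2_coeffs_0[OF compl L2])
    then show "ev f x = 0"
      using continuous_on_open_integral_square_0[OF \<Omega>_domain(1) cont L2] \<open>x \<in> \<Omega>\<close> by blast
  next
    fix f assume f: "f \<in> {f. \<forall>x\<in>\<Omega>. ev f x = 0}"
    have "(LINT y|?M. ev f y * \<phi> n y) = (LINT y|?M. 0)" for n
      using f by (intro Bochner_Integration.integral_cong) auto
    then show "f \<in> orthogonal_comp (range h)"
      by (auto simp: orthogonal_comp_def orthogonal_def inner_commute h)
  qed
  then have "rkhs_local ev \<Omega> = closure (span (range h))"
    by (simp add: rkhs_local_def flip: orthogonal_comp_comp_eq_closure_span)
  then show ?thesis
    unfolding preimage by (auto simp: range_ext)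
qed

end
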